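(* Let $F=K_n$ with $n\ge3$, and let $E_k\subseteq E(F)$ (with $k=n$) be a set of edges such that the subgraph $\mathscr E_k$ induced by $E_k$ is a cycle $C_n$ on all $n$ vertices of $F$. Let $H_{uv}$ be a simple graph of order $m\ge3$ with a specified edge $uv$ such that $u$ and $v$ both have degree $m-1$ in $H_{uv}$, and suppose $H_2=H_{uv}-\{u,v\}$ is $r_2$-regular with $r_2\ge2$. Let $G=G[F,E_k,H_{uv}]$, and let $\zeta,\eta$ be the two roots of $(x-2r_2-2)(x-m)-2(m-2)=0$. Then the spectrum of the signless Laplacian matrix $Q(G)$ is given by: (i) $q$ with multiplicity $n$, for each $q\in\sigma(Q(H_{uv}))\setminus\{m-2,\zeta,\eta\}$; (ii) the two roots of the equation $(x-2m-2n+6)(x-2r_2-2)-4(m-2)=0$, each with multiplicity $1$; (iii) the two roots of the equation $(x-2m-n+6)(x-2r_2-2)-2(m-2)\left(1+\cos\frac{2\pi l}{n}\right)=0$, for each $l=1,2,\ldots,n-1$.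
   Context: All graphs are finite and simple. $Q(X)=D(X)+A(X)$ is the signless Laplacian matrix of a graph $X$ ($D$ the diagonal degree matrix, $A$ the adjacency matrix), and $\sigma(\cdot)$ is the spectrum as a multiset with multiplicity; differences are multiset differences, and the spectrum described by the list is the multiset union of the listed items. For a graph $X$ of order $s$, $q_1(X)\le\cdots\le q_s(X)$ are the eigenvalues of $Q(X)$. Under the stated hypotheses, $\sigma(Q(H_{uv}))=\{q_j(H_2)+2:1\le j\le m-3\}\cup\{m-2,\zeta,\eta\}$ as multisets. $K_n$ is the complete graph and $C_n$ the cycle on $n$ vertices. Graph with $k$ edge-pockets: $H_{uv}$ is a graph with a specified edge $uv$ such that $H_{uv}-u\cong H_{uv}-v$ (automatic when $u,v$ both have degree $m-1$). For $E_k=\{e_1,\ldots,e_k\}\subseteq E(F)$, $G[F,E_k,H_{uv}]$ is obtained by taking one copy of $F$ and $k$ vertex-disjoint copies of $H_{uv}$, and, for each $i=1,\ldots,k$, pasting (identifying) the edge $uv$ of the $i$th copy of $H_{uv}$ with the edge $e_i$ of $F$. *)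

theory Defs
  imports "HOL-Library.Multiset" "Jordan_Normal_Form.Char_Poly"
begin

section \<open>Finite simple graphs\<close>

record 'a ugraph =
  verts :: "'a set"
  edges :: "'a set set"

definition simple_graph :: "'a ugraph \<Rightarrow> bool" where
  "simple_graph X \<longleftrightarrow> finite (verts X) \<and> (\<forall>e\<in>edges X. e \<subseteq> verts X \<and> card e = 2)"

definition order_of :: "'a ugraph \<Rightarrow> nat" where
  "order_of X = card (verts X)"

definition degree_of :: "'a ugraph \<Rightarrow> 'a \<Rightarrow> nat" where
  "degree_of X x = card {y \<in> verts X. {x, y} \<in> edges X}"

definition regular :: "'a ugraph \<Rightarrow> nat \<Rightarrow> bool" where
  "regular X r \<longleftrightarrow> (\<forall>x\<in>verts X. degree_of X x = r)"

definition graph_iso :: "'a ugraph \<Rightarrow> 'b ugraph \<Rightarrow> bool" where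
  "graph_iso X Y \<longleftrightarrow> (\<exists>f. bij_betw f (verts X) (verts Y) \<and>
     (\<forall>x\<in>verts X. \<forall>y\<in>verts X. {x, y} \<in> edges X \<longleftrightarrow> {f x, f y} \<in> edges Y))"

definition delete_verts :: "'a ugraph \<Rightarrow> 'a set \<Rightarrow> 'a ugraph" where
  "delete_verts X S = \<lparr>verts = verts X - S, edges = {e \<in> edges X. e \<inter> S = {}}\<rparr>"

definition edge_induced :: "'a set set \<Rightarrow> 'a ugraph" where
  "edge_induced E = \<lparr>verts = \<Union>E, edges = E\<rparr>"

definition complete_graph :: "nat \<Rightarrow> nat ugraph" where
  "complete_graph n = \<lparr>verts = {0..<n}, edges = {{i, j} | i j. i < n \<and> j < n \<and> i \<noteq> j}\<rparr>"

text \<open>A cycle only for \<open>n \<ge> 3\<close>.\<close>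

definition cycle_graph :: "nat \<Rightarrow> nat ugraph" where
  "cycle_graph n = \<lparr>verts = {0..<n}, edges = {{i, (i + 1) mod n} | i. i < n}\<rparr>"


section \<open>Graphs with edge-pockets\<close>

text \<open>
  The copies of \<open>H\<close> are indexed by the edges \<open>e \<in> E\<close> of \<open>F\<close>. Identifying the edge \<open>uv\<close> of a copy
  with \<open>e\<close> requires a choice of which end of \<open>e\<close> receives \<open>u\<close>: this is \<open>a e\<close>, and \<open>v\<close> goes to
  \<open>b e\<close>, where \<open>e = {a e, b e}\<close>. In the result, \<open>Inl x\<close> is the vertex \<open>x\<close> of \<open>F\<close>, and
  \<open>Inr (e, w)\<close> is the vertex \<open>w \<noteq> u, v\<close> of the copy of \<open>H\<close> belonging to \<open>e\<close>.
\<close>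

definition pocket_map ::
  "('a set \<Rightarrow> 'a) \<Rightarrow> ('a set \<Rightarrow> 'a) \<Rightarrow> 'b \<Rightarrow> 'b \<Rightarrow> 'a set \<Rightarrow> 'b \<Rightarrow> 'a + 'a set \<times> 'b" where
  "pocket_map a b u v e w =
     (if w = u then Inl (a e) else if w = v then Inl (b e) else Inr (e, w))"

definition edge_pockets ::
  "'a ugraph \<Rightarrow> 'a set set \<Rightarrow> ('a set \<Rightarrow> 'a) \<Rightarrow> ('a set \<Rightarrow> 'a) \<Rightarrow> 'b ugraph \<Rightarrow> 'b \<Rightarrow> 'b
     \<Rightarrow> ('a + 'a set \<times> 'b) ugraph" where
  "edge_pockets F E a b H u v =
     \<lparr>verts = Inl ` verts F \<union> (\<Union>e\<in>E. pocket_map a b u v e ` verts H),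
      edges = (`) Inl ` edges F \<union> (\<Union>e\<in>E. (`) (pocket_map a b u v e) ` edges H)\<rparr>"

text \<open>
  The construction is meant for \<open>H - u\<close> isomorphic to \<open>H - v\<close>, which is automatic when both ends
  of \<open>uv\<close> are adjacent to all other vertices.
\<close>

lemma delete_ends_iso:
  assumes H: "simple_graph H" and uv: "{u, v} \<in> edges H"
    and du: "degree_of H u = order_of H - 1" and dv: "degree_of H v = order_of H - 1"
  shows "graph_iso (delete_verts H {u}) (delete_verts H {v})"
proof -
  have fin: "finite (verts H)" and E: "\<And>e. e \<in> edges H \<Longrightarrow> e \<subseteq> verts H \<and> card e = 2"
    using H by (auto simp: simple_graph_def)
  have loop: "{x} \<notin> edges H" for x using E[of "{x}"] by auto
  have uvV: "u \<in> verts H" "v \<in> verts H" using E[OF uv] by auto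
  have ne: "u \<noteq> v" using loop uv by auto
  have dominating: "{w, x} \<in> edges H"
    if "degree_of H w = order_of H - 1" "w \<in> verts H" "x \<in> verts H" "x \<noteq> w" for w x
  proof -
    have "{y \<in> verts H. {w, y} \<in> edges H} \<subseteq> verts H - {w}" using loop by auto
    moreover have "card {y \<in> verts H. {w, y} \<in> edges H} = card (verts H - {w})"
      using that fin by (simp add: degree_of_def order_of_def)
    ultimately have "{y \<in> verts H. {w, y} \<in> edges H} = verts H - {w}"
      using fin by (simp add: card_subset_eq)
    then show ?thesis using that by auto
  qed
  have adj: "{u, x} \<in> edges H" "{x, u} \<in> edges H" if "x \<in> verts H" "x \<noteq> u" for x
    using dominating[OF du uvV(1) that] by (simp_all add: insert_commute)
  have adj': "{v, x} \<in> edges H" "{x, v} \<in> edges H" if "x \<in> verts H" "x \<noteq> v" for x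
    using dominating[OF dv uvV(2) that] by (simp_all add: insert_commute)
  let ?f = "\<lambda>x. if x = v then u else x"
  have "bij_betw ?f (verts H - {u}) (verts H - {v})"
    by (rule bij_betw_byWitness[where f' = "\<lambda>x. if x = u then v else x"]) (use uvV ne in auto)
  moreover have "{x, y} \<in> edges (delete_verts H {u}) \<longleftrightarrow> {?f x, ?f y} \<in> edges (delete_verts H {v})"
    if "x \<in> verts H - {u}" "y \<in> verts H - {u}" for x y
    using that loop ne by (auto simp: delete_verts_def adj adj')
  ultimately show ?thesis
    unfolding graph_iso_def by (intro exI[of _ ?f]) (auto simp: delete_verts_def)
qed


section \<open>The spectrum of the signless Laplacian\<close>

text \<open>
  Matrices are indexed by positions in an enumeration \<open>vs\<close> of the vertices, and have complex entries
  so that the characteristic polynomial splits: the spectrum of a graph of order \<open>s\<close> always has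
  \<open>s\<close> elements, counted with multiplicity.
\<close>

definition adjacency_mat :: "'a list \<Rightarrow> 'a ugraph \<Rightarrow> complex mat" where
  "adjacency_mat vs X = mat (length vs) (length vs)
     (\<lambda>(i, j). if {vs ! i, vs ! j} \<in> edges X then 1 else 0)"

definition degree_mat :: "'a list \<Rightarrow> 'a ugraph \<Rightarrow> complex mat" where
  "degree_mat vs X = mat (length vs) (length vs)
     (\<lambda>(i, j). if i = j then of_nat (degree_of X (vs ! i)) else 0)"

definition signless_laplacian :: "'a list \<Rightarrow> 'a ugraph \<Rightarrow> complex mat" where
  "signless_laplacian vs X = degree_mat vs X + adjacency_mat vs X"

definition Q :: "'a ugraph \<Rightarrow> complex mat" where
  "Q X = signless_laplacian (SOME vs. distinct vs \<and> set vs = verts X) X"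

definition spectrum :: "complex mat \<Rightarrow> complex multiset" (\<open>\<sigma>\<close>) where
  "\<sigma> M = proots (char_poly M)"

text \<open>The indeterminate, so that the roots of an equation \<open>p(x) = 0\<close>, counted with multiplicity,
  can be written \<open>proots (p(\<xi>))\<close>.\<close>

abbreviation indeterminate :: "complex poly" (\<open>\<xi>\<close>) where
  "\<xi> \<equiv> [:0, 1:]"

text \<open>The choice of the enumeration in \<open>Q\<close> is immaterial.\<close>

lemma spectrum_Q_enum:
  assumes vs: "distinct vs" "set vs = verts X"
  shows "\<sigma> (Q X) = \<sigma> (signless_laplacian vs X)"
proof -
  define ws where "ws = (SOME vs. distinct vs \<and> set vs = verts X)"
  have "distinct ws \<and> set ws = verts X"
    unfolding ws_def by (rule someI[of _ vs]) (use vs in simp)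
  then have ws: "distinct ws" "set ws = verts X" by auto
  define n where "n = length vs"
  have len: "length vs = n" "length ws = n"
    using vs ws by (metis n_def distinct_card)+
  define f where "f x y = (if x = y then of_nat (degree_of X x) else 0) +
    (if {x, y} \<in> edges X then 1 else 0 :: complex)" for x y
  define P :: "'a list \<Rightarrow> 'a list \<Rightarrow> complex mat" where
    "P xs ys = mat n n (\<lambda>(i, j). if xs ! i = ys ! j then 1 else 0)" for xs ys
  have lap: "signless_laplacian xs X = mat n n (\<lambda>(i, j). f (xs ! i) (xs ! j))"
    if "distinct xs" "length xs = n" for xs
    using that
    by (intro eq_matI)
       (auto simp: signless_laplacian_def degree_mat_def adjacency_mat_def f_def nth_eq_iff_index_eq)
  have sum_P: "(\<Sum>k = 0..<n. g (ys ! k) * (if ys ! k = x then 1 else 0)) = g x"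
    if "distinct ys" "length ys = n" "x \<in> set ys" for g :: "'a \<Rightarrow> complex" and ys x
  proof -
    have "(\<Sum>k = 0..<n. g (ys ! k) * (if ys ! k = x then 1 else 0)) =
        (\<Sum>y\<in>set ys. g y * (if y = x then 1 else 0))"
      using that by (intro sum.reindex_bij_betw bij_betw_nth) auto
    also have "\<dots> = (\<Sum>y\<in>set ys. if y = x then g y else 0)" by (intro sum.cong) auto
    also have "\<dots> = g x" using that by simp
    finally show ?thesis .
  qed
  have PP: "P xs ys * P ys xs = 1\<^sub>m n"
    if "distinct xs" "length xs = n" "distinct ys" "length ys = n" "set xs = set ys" for xs ys
  proof (rule eq_matI)
    fix i j assume "i < dim_row (1\<^sub>m n)" "j < dim_col (1\<^sub>m n)"
    then have ij: "i < n" "j < n" by auto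
    have "xs ! j \<in> set ys" using that ij by (metis nth_mem)
    then have "(\<Sum>k = 0..<n. (if xs ! i = ys ! k then 1 else 0 :: complex) *
        (if ys ! k = xs ! j then 1 else 0)) = (if xs ! i = xs ! j then 1 else 0)"
      using sum_P[of ys "xs ! j" "\<lambda>y. if xs ! i = y then 1 else 0"] that by simp
    then show "(P xs ys * P ys xs) $$ (i, j) = 1\<^sub>m n $$ (i, j)"
      using ij that by (simp add: P_def scalar_prod_def nth_eq_iff_index_eq)
  qed (auto simp: P_def)
  have LP: "mat n n (\<lambda>(i, j). f (ws ! i) (ws ! j)) * P ws vs =
      mat n n (\<lambda>(i, j). f (ws ! i) (vs ! j))"
  proof (rule eq_matI)
    fix i j
    assume "i < dim_row (mat n n (\<lambda>(i, j). f (ws ! i) (vs ! j)))"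
      "j < dim_col (mat n n (\<lambda>(i, j). f (ws ! i) (vs ! j)))"
    then have ij: "i < n" "j < n" by auto
    have "vs ! j \<in> set ws" using ij vs ws len by (metis nth_mem)
    then show "(mat n n (\<lambda>(i, j). f (ws ! i) (ws ! j)) * P ws vs) $$ (i, j) =
        mat n n (\<lambda>(i, j). f (ws ! i) (vs ! j)) $$ (i, j)"
      using ij len ws sum_P[of ws "vs ! j" "\<lambda>y. f (ws ! i) y"]
      by (simp add: P_def scalar_prod_def)
  qed (auto simp: P_def)
  have PL: "P ws vs * mat n n (\<lambda>(i, j). f (vs ! i) (vs ! j)) =
      mat n n (\<lambda>(i, j). f (ws ! i) (vs ! j))"
  proof (rule eq_matI)
    fix i j
    assume "i < dim_row (mat n n (\<lambda>(i, j). f (ws ! i) (vs ! j)))"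
      "j < dim_col (mat n n (\<lambda>(i, j). f (ws ! i) (vs ! j)))"
    then have ij: "i < n" "j < n" by auto
    have "ws ! i \<in> set vs" using ij vs ws len by (metis nth_mem)
    then show "(P ws vs * mat n n (\<lambda>(i, j). f (vs ! i) (vs ! j))) $$ (i, j) =
        mat n n (\<lambda>(i, j). f (ws ! i) (vs ! j)) $$ (i, j)"
      using ij len vs sum_P[of vs "ws ! i" "\<lambda>y. f y (vs ! j)"]
      by (simp add: P_def scalar_prod_def mult.commute eq_commute[of "ws ! i"])
  qed (auto simp: P_def)
  let ?A = "signless_laplacian ws X" and ?B = "signless_laplacian vs X"
  have carr: "?A \<in> carrier_mat n n" "?B \<in> carrier_mat n n"
    "P ws vs \<in> carrier_mat n n" "P vs ws \<in> carrier_mat n n"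
    using lap len vs ws by (auto simp: P_def)
  have comm: "?A * P ws vs = P ws vs * ?B"
    using LP PL lap len vs ws by simp
  have "P ws vs * ?B * P vs ws = ?A * (P ws vs * P vs ws)"
    using assoc_mult_mat[OF carr(1,3,4)] by (simp add: comm)
  also have "\<dots> = ?A" using PP[of ws vs] vs ws len carr by simp
  finally have "similar_mat ?A ?B"
    by (intro similar_matI[of _ _ "P ws vs" "P vs ws" n]) (use PP vs ws len carr in auto)
  then show ?thesis
    by (simp add: spectrum_def Q_def ws_def char_poly_similar)
qed

end

theory Submission
  imports Defs
begin

text \<open>
  List the vertices of \<open>G\<close> as those of \<open>F\<close> followed by the interior vertices of the \<open>n\<close> copies of
  \<open>H\<close>. The lower right block of \<open>\<xi> I - Q(G)\<close> then consists of \<open>n\<close> diagonal copies of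
  \<open>\<xi> I - (Q(H\<^sub>2) + 2 I)\<close>, whose row sums are \<open>s = \<xi> - 2 r\<^sub>2 - 2\<close> by regularity. With \<open>\<phi>\<close> the
  determinant of one copy and \<open>C\<close> the adjacency matrix of the cycle, the Schur complement gives
  \<open>det (\<xi> I - Q(G)) s\<^sup>n = det (s ((\<xi> - n - 2 m + 6) I - J) - (m - 2) (2 I + C)) \<phi>\<^sup>n\<close>. The first factor is
  a circulant determinant, which the discrete Fourier transform splits into the quadratics of (ii)
  and (iii). The same computation for \<open>H\<close> gives
  \<open>det (\<xi> I - Q(H)) s = (\<xi> - m + 2) (s (\<xi> - m) - 2 (m - 2)) \<phi>\<close>. As \<open>s\<close> divides \<open>\<phi>\<close>, the roots of
  \<open>\<phi> / s\<close> are the elements of \<open>\<sigma>(Q(H))\<close> other than \<open>m - 2, \<zeta>, \<eta>\<close>.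
\<close>


section \<open>Matrices indexed by lists\<close>

text \<open>Entries are functions of the vertices themselves, so that splitting the vertex list by
  \<open>append\<close> splits the matrix into blocks and no index arithmetic on positions is
  needed.\<close>

definition list_mat :: "('x \<Rightarrow> 'y \<Rightarrow> 'r) \<Rightarrow> 'x list \<Rightarrow> 'y list \<Rightarrow> 'r mat" where
  "list_mat K xs ys = mat (length xs) (length ys) (\<lambda>(i, j). K (xs ! i) (ys ! j))"

lemma list_mat_carrier [simp]: "list_mat K xs ys \<in> carrier_mat (length xs) (length ys)"
  by (simp add: list_mat_def)

lemma list_mat_dim [simp]:
  "dim_row (list_mat K xs ys) = length xs" "dim_col (list_mat K xs ys) = length ys"
  by (simp_all add: list_mat_def)

lemma list_mat_index [simp]:
  "i < length xs \<Longrightarrow> j < length ys \<Longrightarrow> list_mat K xs ys $$ (i, j) = K (xs ! i) (ys ! j)"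
  by (simp add: list_mat_def)

lemma list_mat_cong:
  assumes "\<And>x y. x \<in> set xs \<Longrightarrow> y \<in> set ys \<Longrightarrow> K x y = L x y"
  shows "list_mat K xs ys = list_mat L xs ys"
  by (rule eq_matI) (auto simp: assms)

lemma list_mat_map: "list_mat K (map f xs) (map g ys) = list_mat (\<lambda>x y. K (f x) (g y)) xs ys"
  by (rule eq_matI) auto

lemma list_mat_append:
  "list_mat K (xs @ ys) (xs' @ ys') =
    four_block_mat (list_mat K xs xs') (list_mat K xs ys') (list_mat K ys xs') (list_mat K ys ys')"
  by (rule eq_matI) (auto simp: nth_append)

lemma list_mat_mult:
  fixes K :: "'x \<Rightarrow> 'y \<Rightarrow> 'r :: semiring_0"
  shows "list_mat K xs ys * list_mat L ys zs =
    list_mat (\<lambda>x z. \<Sum>y\<leftarrow>ys. K x y * L y z) xs zs"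
  by (rule eq_matI) (auto simp: scalar_prod_def sum_list_sum_nth)

text \<open>
  The Schur complement without inverses: as \<open>s\<close> times the lower left block is the lower right block
  times the lower left block, multiplying on the right by \<open>[[s I, 0], [- K(ys, xs), I]]\<close> clears the
  lower left block.
\<close>

lemma det_list_mat_schur:
  fixes K :: "'x \<Rightarrow> 'x \<Rightarrow> 'r :: idom"
  assumes "\<And>y x. y \<in> set ys \<Longrightarrow> x \<in> set xs \<Longrightarrow> (\<Sum>z\<leftarrow>ys. K y z * K z x) = s * K y x"
  shows "det (list_mat K (xs @ ys) (xs @ ys)) * s ^ length xs =
    det (list_mat (\<lambda>x x'. s * K x x' - (\<Sum>z\<leftarrow>ys. K x z * K z x')) xs xs) * det (list_mat K ys ys)"
proof -
  let ?k = "length xs" and ?l = "length ys"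
  let ?S = "list_mat (\<lambda>x x'. s * K x x' - (\<Sum>z\<leftarrow>ys. K x z * K z x')) xs xs"
  let ?T = "four_block_mat (s \<cdot>\<^sub>m 1\<^sub>m ?k) (0\<^sub>m ?k ?l) (- list_mat K ys xs) (1\<^sub>m ?l)"
  have T: "?T \<in> carrier_mat (?k + ?l) (?k + ?l)" by (intro four_block_carrier_mat) auto
  have "list_mat K (xs @ ys) (xs @ ys) * ?T =
    four_block_mat ?S (list_mat K xs ys) (0\<^sub>m ?l ?k) (list_mat K ys ys)"
  proof -
    have "list_mat K xs xs * (s \<cdot>\<^sub>m 1\<^sub>m ?k) + list_mat K xs ys * (- list_mat K ys xs) = ?S"
      by (subst mult_smult_distrib[of _ ?k ?k _ ?k])
        (auto intro!: eq_matI simp: list_mat_mult uminus_mult_right_mat[symmetric])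
    moreover have "list_mat K ys xs * (s \<cdot>\<^sub>m 1\<^sub>m ?k) + list_mat K ys ys * (- list_mat K ys xs)
        = 0\<^sub>m ?l ?k"
      by (subst mult_smult_distrib[of _ ?l ?k _ ?k])
        (auto intro!: eq_matI simp: list_mat_mult uminus_mult_right_mat[symmetric] assms)
    ultimately show ?thesis
      unfolding list_mat_append
      by (subst mult_four_block_mat[of _ ?k ?k _ ?l _ ?l _ _ ?k _ ?l]) auto
  qed
  moreover have "det ?T = s ^ ?k"
    by (subst det_four_block_mat_upper_right_zero[of _ ?k _ ?l]) auto
  moreover have "det (four_block_mat ?S (list_mat K xs ys) (0\<^sub>m ?l ?k) (list_mat K ys ys)) =
      det ?S * det (list_mat K ys ys)"
    by (rule det_four_block_mat_lower_left_zero[of _ ?k _ ?l]) auto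
  ultimately show ?thesis
    using det_mult[OF _ T, of "list_mat K (xs @ ys) (xs @ ys)"] list_mat_carrier[of K "xs @ ys" "xs @ ys"]
    by simp
qed

lemma det_list_mat_append_zero:
  fixes K :: "'x \<Rightarrow> 'x \<Rightarrow> 'r :: idom"
  assumes "\<And>y x. y \<in> set ys \<Longrightarrow> x \<in> set xs \<Longrightarrow> K y x = 0"
  shows "det (list_mat K (xs @ ys) (xs @ ys)) = det (list_mat K xs xs) * det (list_mat K ys ys)"
  unfolding list_mat_append
  by (rule det_four_block_mat_lower_left_zero[of _ "length xs" _ "length ys"])
    (auto intro!: eq_matI simp: assms)

text \<open>\<open>g e\<close> places \<open>ws\<close> in the copy belonging to \<open>e\<close>.
  Different copies do not interact, so the matrix is block diagonal with equal blocks, which are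
  split off one at a time.\<close>

lemma det_list_mat_copies:
  fixes K :: "'x \<Rightarrow> 'x \<Rightarrow> 'r :: idom"
  assumes "distinct es"
    and "\<And>e x y. e \<in> set es \<Longrightarrow> x \<in> set ws \<Longrightarrow> y \<in> set ws \<Longrightarrow> K (g e x) (g e y) = L x y"
    and "\<And>e e' x y. e \<in> set es \<Longrightarrow> e' \<in> set es \<Longrightarrow> e \<noteq> e' \<Longrightarrow> x \<in> set ws \<Longrightarrow> y \<in> set ws \<Longrightarrow>
      K (g e x) (g e' y) = 0"
  shows "det (list_mat K (concat (map (\<lambda>e. map (g e) ws) es)) (concat (map (\<lambda>e. map (g e) ws) es)))
    = det (list_mat L ws ws) ^ length es"
  using assms
proof (induction es)
  case Nil
  have "list_mat K [] [] = 1\<^sub>m 0" by (rule eq_matI) auto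
  then show ?case by simp
next
  case (Cons e es)
  let ?c = "concat (map (\<lambda>e. map (g e) ws) es)"
  have "det (list_mat K (map (g e) ws @ ?c) (map (g e) ws @ ?c)) =
      det (list_mat K (map (g e) ws) (map (g e) ws)) * det (list_mat K ?c ?c)"
    using Cons.prems by (intro det_list_mat_append_zero) (auto; metis)
  moreover have "list_mat K (map (g e) ws) (map (g e) ws) = list_mat L ws ws"
    unfolding list_mat_map using Cons.prems by (intro list_mat_cong) auto
  moreover have "det (list_mat K ?c ?c) = det (list_mat L ws ws) ^ length es"
    using Cons.prems by (intro Cons.IH) auto
  ultimately show ?case by simp
qed

text \<open>Blocks of size 1 over a commutative ring commute, which allows the formula det(A D - B
  C) for a block matrix.\<close>

lemma det_list_mat_pair:
  fixes K :: "'x \<Rightarrow> 'x \<Rightarrow> 'r :: idom"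
  shows "det (list_mat K [x, y] [x, y]) = K x x * K y y - K x y * K y x"
proof -
  have c: "list_mat K [x] [y] \<in> carrier_mat 1 1" for x y
    using list_mat_carrier[of K "[x]" "[y]"] by simp
  have "det (list_mat K ([x] @ [y]) ([x] @ [y])) =
      det (list_mat K [x] [x] * list_mat K [y] [y] - list_mat K [x] [y] * list_mat K [y] [x])"
    unfolding list_mat_append
    by (rule det_four_block_mat[of _ 1]) (auto simp: c list_mat_mult scalar_prod_def intro!: eq_matI)
  also have "\<dots> = K x x * K y y - K x y * K y x"
    by (subst det_single) (auto simp: c list_mat_mult scalar_prod_def)
  finally show ?thesis by simp
qed

text \<open>Evaluation at \<open>c\<close> commutes with the determinant, and the evaluated matrix
  annihilates the all-ones vector, which is nonzero because \<open>ys\<close> is nonempty.\<close>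

lemma root_det_list_mat:
  fixes K :: "'x \<Rightarrow> 'x \<Rightarrow> 'r :: idom poly"
  assumes "ys \<noteq> []" and "\<And>y. y \<in> set ys \<Longrightarrow> (\<Sum>z\<leftarrow>ys. poly (K y z) c) = 0"
  shows "poly (det (list_mat K ys ys)) c = 0"
proof -
  let ?n = "length ys"
  let ?A = "list_mat (\<lambda>y z. poly (K y z) c) ys ys"
  let ?v = "vec ?n (\<lambda>_. 1 :: 'r)"
  have "?A *\<^sub>v ?v = 0\<^sub>v ?n"
  proof (rule eq_vecI)
    fix i assume "i < dim_vec (0\<^sub>v ?n :: 'r vec)"
    then have i: "i < ?n" by simp
    then have "(?A *\<^sub>v ?v) $ i = (\<Sum>z\<leftarrow>ys. poly (K (ys ! i) z) c)"
      by (simp add: scalar_prod_def sum_list_sum_nth)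
    then show "(?A *\<^sub>v ?v) $ i = 0\<^sub>v ?n $ i" using assms(2)[of "ys ! i"] i by simp
  qed simp
  moreover have "?v \<noteq> 0\<^sub>v ?n"
  proof
    assume "?v = 0\<^sub>v ?n"
    then have "?v $ 0 = 0\<^sub>v ?n $ 0" by simp
    moreover have "0 < ?n" using assms(1) by simp
    ultimately show False by (simp only: index_vec index_zero_vec zero_neq_one[symmetric])
  qed
  moreover have "?v \<in> carrier_vec ?n" "?A \<in> carrier_mat ?n ?n" by simp_all
  ultimately have "det ?A = 0"
    using det_0_iff_vec_prod_zero[of ?A ?n] by metis
  moreover have "poly (det (list_mat K ys ys)) c = det ?A"
    by (rule poly_det_cong[of _ ?n]) auto
  ultimately show ?thesis by simp
qed

section \<open>Circulant determinants\<close>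

text \<open>For \<open>k \<noteq> 0\<close> the ratio is an \<open>n\<close>-th root of unity other
  than 1, since \<open>n\<close> does not divide \<open>k\<close>; the geometric sum then
  vanishes.\<close>

lemma sum_root_unity:
  fixes k n :: nat
  assumes "k < n"
  shows "(\<Sum>j<n. cis (2 * pi * k / n) ^ j) = (if k = 0 then of_nat n else 0)"
proof (cases "k = 0")
  case False
  have "cis (2 * pi * k / n) \<noteq> 1"
  proof
    assume "cis (2 * pi * k / n) = 1"
    then have "cos (2 * pi * k / n) = 1" by (metis cis.sel(1) one_complex.sel(1))
    then obtain i where "2 * pi * k / n = 2 * pi * real_of_int i"
      by (auto simp: cos_one_2pi_int mult_ac)
    then have "real k = of_int i * n" using assms by (simp add: field_simps)
    then have "int k = i * int n"
      by (metis of_int_eq_iff of_int_mult of_int_of_nat_eq)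
    then have "int n dvd int k" by simp
    then have "n dvd k" by presburger
    with assms False show False by (auto dest: dvd_imp_le)
  qed
  moreover have "cis (2 * pi * k / n) ^ n = 1"
    using assms cis_multiple_2pi[of k] by (simp add: Complex.DeMoivre mult_ac)
  ultimately show ?thesis using False by (simp add: geometric_sum)
qed simp

text \<open>The columns of the discrete Fourier matrix are eigenvectors, with eigenvalues \<open>\<mu> l\<close>.\<close>

lemma det_circulant:
  fixes A :: "complex poly mat" and n :: nat and \<mu> :: "nat \<Rightarrow> complex poly"
  defines "w \<equiv> \<lambda>l :: nat. cis (2 * pi * l / n)"
  assumes A: "A \<in> carrier_mat n n"
    and ev: "\<And>i l. i < n \<Longrightarrow> l < n \<Longrightarrow> (\<Sum>j<n. A $$ (i, j) * [:w l ^ j:]) = \<mu> l * [:w l ^ i:]"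
  shows "det A = (\<Prod>l<n. \<mu> l)"
proof (cases "n = 0")
  case True
  with A have "A = 1\<^sub>m 0" by auto
  with True show ?thesis by simp
next
  case False
  \<comment> \<open>\<open>W\<close> is the Fourier matrix, \<open>V\<close> its conjugate transpose
    and \<open>D\<close> the diagonal matrix of eigenvalues. Orthogonality makes
    \<open>V * W\<close> a nonzero scalar matrix, so \<open>det W\<close> can be cancelled from
    \<open>A * W = W * D\<close>.\<close>
  define W where "W = mat n n (\<lambda>(j, l). [:w l ^ j:])"
  define V where "V = mat n n (\<lambda>(l, j). [:cnj (w l) ^ j:])"
  define D where "D = mat n n (\<lambda>(l, l'). if l = l' then \<mu> l else 0)"
  have WVD: "W \<in> carrier_mat n n" "V \<in> carrier_mat n n" "D \<in> carrier_mat n n"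
    by (auto simp: W_def V_def D_def)
  have orth: "(\<Sum>j<n. cnj (w l) ^ j * w l' ^ j) = (if l = l' then of_nat n else 0)"
    if "l < n" "l' < n" for l l'
  proof -
    \<comment> \<open>The sum of roots of unity is applied at the natural number
      \<open>l' - l\<close>, hence \<open>l \<le> l'\<close> first; the other case is the complex
      conjugate of this one.\<close>
    have *: "(\<Sum>j<n. cnj (w l) ^ j * w l' ^ j) = (if l = l' then of_nat n else 0)"
      if "l \<le> l'" "l' < n" for l l'
    proof -
      have "cnj (w l) * w l' = cis (2 * pi * (l' - l) / n)"
        using that by (simp add: w_def cis_cnj cis_mult of_nat_diff diff_divide_distrib algebra_simps)
      with that sum_root_unity[of "l' - l" n] show ?thesis
        by (auto simp: power_mult_distrib[symmetric])
    qed
    show ?thesis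
    proof (cases "l \<le> l'")
      case False
      have "(\<Sum>j<n. cnj (w l) ^ j * w l' ^ j) = cnj (\<Sum>j<n. cnj (w l') ^ j * w l ^ j)"
        by (simp add: mult.commute)
      then show ?thesis using *[of l' l] False that by auto
    qed (use * that in auto)
  qed
  have "V * W = of_nat n \<cdot>\<^sub>m 1\<^sub>m n"
  proof (rule eq_matI)
    fix l l' assume "l < dim_row (of_nat n \<cdot>\<^sub>m 1\<^sub>m n)" "l' < dim_col (of_nat n \<cdot>\<^sub>m 1\<^sub>m n)"
    then have l: "l < n" "l' < n" by auto
    have "(V * W) $$ (l, l') = [:\<Sum>j<n. cnj (w l) ^ j * w l' ^ j:]"
      using l by (simp add: V_def W_def scalar_prod_def lessThan_atLeast0 sum_to_poly mult_ac)
    then show "(V * W) $$ (l, l') = (of_nat n \<cdot>\<^sub>m 1\<^sub>m n) $$ (l, l')"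
      using l by (simp add: orth of_nat_poly)
  qed (auto simp: V_def W_def)
  then have "det V * det W = of_nat n ^ n"
    using WVD by (metis det_mult det_smult det_one mult.right_neutral index_one_mat(3))
  then have "det W \<noteq> 0" using False by auto
  have "A * W = W * D"
  proof (rule eq_matI)
    fix i l assume "i < dim_row (W * D)" "l < dim_col (W * D)"
    then have l: "i < n" "l < n" by (auto simp: W_def D_def)
    have "(A * W) $$ (i, l) = \<mu> l * [:w l ^ i:]"
      using l A ev[OF l] by (simp add: W_def scalar_prod_def lessThan_atLeast0)
    moreover have "(W * D) $$ (i, l) = (\<Sum>j = 0..<n. [:w j ^ i:] * (if j = l then \<mu> j else 0))"
      using l by (auto simp: W_def D_def scalar_prod_def simp del: mult_pCons_left intro!: sum.cong)
    moreover have "\<dots> = (\<Sum>j = 0..<n. if j = l then [:w j ^ i:] * \<mu> j else 0)"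
      by (intro sum.cong) auto
    ultimately show "(A * W) $$ (i, l) = (W * D) $$ (i, l)" using l by (simp add: mult_ac)
  qed (use A in \<open>auto simp: W_def D_def\<close>)
  then have "det A * det W = det W * det D" using A WVD by (metis det_mult)
  then have "det A = det D" using \<open>det W \<noteq> 0\<close> by simp
  also have "\<dots> = prod_list (diag_mat D)"
    by (rule det_upper_triangular[OF _ WVD(3)]) (auto simp: D_def)
  also have "\<dots> = (\<Prod>l<n. \<mu> l)"
    by (simp add: prod_list_diag_prod D_def lessThan_atLeast0)
  finally show ?thesis .
qed

text \<open>Solves adjacency for \<open>j\<close>. Writing the predecessor of \<open>i\<close> as
  \<open>(i + (n - 1)) mod n\<close> covers \<open>i = 0\<close> as well and lets a power with this
  exponent split into a product.\<close>

lemma cycle_neighbours: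
  fixes i j n :: nat
  assumes "n \<ge> 3" "i < n" "j < n"
  shows "j = (i + 1) mod n \<or> i = (j + 1) mod n \<longleftrightarrow> j = (i + 1) mod n \<or> j = (i + (n - 1)) mod n"
proof -
  have "(i + (n - 1)) mod n = (if i = 0 then n - 1 else i - 1)"
    using assms by (auto simp: mod_if)
  moreover have "(j + 1) mod n = (if j = n - 1 then 0 else j + 1)"
    using assms by (auto simp: mod_if)
  moreover have "(i + 1) mod n = (if i = n - 1 then 0 else i + 1)"
    using assms by (auto simp: mod_if)
  ultimately show ?thesis using assms by auto
qed

text \<open>For \<open>n = 2\<close> successor and predecessor coincide; from \<open>n = 3\<close>
  on they are two different neighbours.\<close>

lemma cycle_neighbours_distinct:
  fixes i n :: nat
  assumes "n \<ge> 3" "i < n"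
  shows "(i + 1) mod n \<noteq> (i + (n - 1)) mod n"
  using assms by (auto simp: mod_if split: if_splits)

text \<open>The matrix is \<alpha> I + \<beta> J + \<gamma> C with J all ones and C the adjacency
  matrix of the cycle. On the Fourier vector of index \<open>l\<close>, J has eigenvalue
  \<open>n\<close> if \<open>l = 0\<close> and 0 otherwise, and C has twice the cosine. The factor
  of index 0 is written separately.\<close>

lemma det_cycle_circulant:
  fixes \<alpha> \<beta> \<gamma> :: "complex poly"
  assumes n: "n \<ge> 3"
  shows "det (mat n n (\<lambda>(i, j). (if i = j then \<alpha> else 0) + \<beta> +
      (if j = (i + 1) mod n \<or> i = (j + 1) mod n then \<gamma> else 0))) =
    (\<alpha> + of_nat n * \<beta> + 2 * \<gamma>) *
    (\<Prod>l = 1..n - 1. \<alpha> + 2 * \<gamma> * [:of_real (cos (2 * pi * real l / real n)):])"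
proof -
  define w :: "nat \<Rightarrow> complex" where "w = (\<lambda>l. cis (2 * pi * l / n))"
  define \<mu> where "\<mu> l = \<alpha> + (if l = 0 then of_nat n else 0) * \<beta> +
    2 * \<gamma> * [:of_real (cos (2 * pi * real l / real n)):]" for l :: nat
  let ?a = "\<lambda>i j. (if i = j then \<alpha> else 0) + \<beta> +
      (if j = (i + 1) mod n \<or> i = (j + 1) mod n then \<gamma> else 0)"
  have wn: "w l ^ n = 1" for l
    using n cis_multiple_2pi[of l] by (simp add: w_def Complex.DeMoivre mult_ac)
  have wmod: "w l ^ (k mod n) = w l ^ k" for l k
  proof -
    have "w l ^ k = w l ^ (n * (k div n) + k mod n)" by simp
    also have "\<dots> = w l ^ (k mod n)" unfolding power_add power_mult wn by simp
    finally show ?thesis by simp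
  qed
  have main: "(\<Sum>j<n. ?a i j * [:w l ^ j:]) = \<mu> l * [:w l ^ i:]" if i: "i < n" and l: "l < n" for i l
  proof -
    define p where "p = (i + 1) mod n"
    define q where "q = (i + (n - 1)) mod n"
    have adj: "j = (i + 1) mod n \<or> i = (j + 1) mod n \<longleftrightarrow> j = p \<or> j = q" if "j < n" for j
      unfolding p_def q_def by (rule cycle_neighbours[OF n i that])
    have pq: "p \<noteq> q" "p < n" "q < n"
      using cycle_neighbours_distinct[OF n i] n by (simp_all add: p_def q_def)
    \<comment> \<open>Since \<open>p \<noteq> q\<close>, the indicator of being a neighbour is the
      sum of two single indicators, and each of these sums collapses to one term.\<close>
    have "(\<Sum>j<n. ?a i j * [:w l ^ j:]) = (\<Sum>j<n. (if j = i then \<alpha> * [:w l ^ j:] else 0)) +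
        \<beta> * (\<Sum>j<n. [:w l ^ j:]) + (\<Sum>j<n. if j = p then \<gamma> * [:w l ^ j:] else 0) +
        (\<Sum>j<n. if j = q then \<gamma> * [:w l ^ j:] else 0)"
      unfolding sum_distrib_left sum.distrib[symmetric]
    proof (intro sum.cong refl)
      fix j assume "j \<in> {..<n}"
      then have "j < n" by simp
      show "?a i j * [:w l ^ j:] = (if j = i then \<alpha> * [:w l ^ j:] else 0) +
        \<beta> * [:w l ^ j:] + (if j = p then \<gamma> * [:w l ^ j:] else 0) +
        (if j = q then \<gamma> * [:w l ^ j:] else 0)"
        unfolding adj[OF \<open>j < n\<close>] using \<open>p \<noteq> q\<close>
        by (auto simp: distrib_right simp del: mult_pCons_right)
    qed
    also have "\<dots> = \<alpha> * [:w l ^ i:] + \<beta> * [:\<Sum>j<n. w l ^ j:] + (\<gamma> * [:w l ^ p:] + \<gamma> * [:w l ^ q:])"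
      using i pq by (simp add: sum_to_poly add.assoc del: mult_pCons_right)
    also have "[:\<Sum>j<n. w l ^ j:] = (if l = 0 then of_nat n else 0) * [:w l ^ i:]"
      using sum_root_unity[OF l] by (auto simp: w_def of_nat_poly)
    also have "\<gamma> * [:w l ^ p:] + \<gamma> * [:w l ^ q:] = \<gamma> * [:w l ^ i:] * [:w l + w l ^ (n - 1):]"
    proof -
      have "w l ^ p = w l ^ i * w l" "w l ^ q = w l ^ i * w l ^ (n - 1)"
        unfolding p_def q_def wmod power_add by simp_all
      then have "[:w l ^ p:] + [:w l ^ q:] = [:w l ^ i:] * [:w l + w l ^ (n - 1):]"
        by (simp add: algebra_simps)
      then show ?thesis by (metis distrib_left mult.assoc)
    qed
    \<comment> \<open>\<open>w l ^ (n - 1)\<close> is the inverse of \<open>w l\<close>, hence its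
      conjugate, and the sum is twice the real part.\<close>
    also have "w l + w l ^ (n - 1) = 2 * of_real (cos (2 * pi * real l / real n))"
    proof -
      have "w l * w l ^ (n - 1) = 1" using wn[of l] n by (simp flip: power_Suc)
      moreover have "w l * cnj (w l) = 1" by (simp add: w_def cis_cnj cis_mult)
      ultimately have "w l ^ (n - 1) = cnj (w l)"
        by (metis mult_cancel_left mult_zero_left zero_neq_one)
      then show ?thesis by (simp add: complex_add_cnj w_def)
    qed
    finally have "(\<Sum>j<n. ?a i j * [:w l ^ j:]) = \<alpha> * [:w l ^ i:] +
      \<beta> * ((if l = 0 then of_nat n else 0) * [:w l ^ i:]) +
      \<gamma> * [:w l ^ i:] * [:2 * complex_of_real (cos (2 * pi * real l / real n)):]" by (simp only: add.assoc)
    moreover have "[:2 * complex_of_real (cos (2 * pi * real l / real n)):] =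
        2 * [:complex_of_real (cos (2 * pi * real l / real n)):]" by (simp add: numeral_poly)
    moreover have "\<alpha> * x + \<beta> * (z * x) + \<gamma> * x * (2 * c) = (\<alpha> + z * \<beta> + 2 * \<gamma> * c) * x" for x z c
      by (simp add: algebra_simps)
    ultimately show ?thesis by (simp only: \<mu>_def)
  qed
  have "det (mat n n (\<lambda>(i, j). ?a i j)) = (\<Prod>l<n. \<mu> l)"
  proof (rule det_circulant)
    fix i l assume *: "i < n" "l < n"
    have "(\<Sum>j<n. mat n n (\<lambda>(i, j). ?a i j) $$ (i, j) * [:w l ^ j:]) = (\<Sum>j<n. ?a i j * [:w l ^ j:])"
      by (intro sum.cong) (simp_all add: * del: mult_pCons_right)
    with main[OF *] show "(\<Sum>j<n. mat n n (\<lambda>(i, j). ?a i j) $$ (i, j) *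
        [:cis (2 * pi * real l / real n) ^ j:]) = \<mu> l * [:cis (2 * pi * real l / real n) ^ i:]"
      unfolding w_def by (rule trans[rotated])
  qed simp
  also have "{..<n} = insert 0 {1..n - 1}" using n by auto
  also have "(\<Prod>l\<in>insert 0 {1..n - 1}. \<mu> l) = \<mu> 0 * (\<Prod>l = 1..n - 1. \<mu> l)" by simp
  also have "(\<Prod>l = 1..n - 1. \<mu> l) =
      (\<Prod>l = 1..n - 1. \<alpha> + 2 * \<gamma> * [:of_real (cos (2 * pi * real l / real n)):])"
    by (intro prod.cong) (auto simp: \<mu>_def)
  also have "\<mu> 0 = \<alpha> + of_nat n * \<beta> + 2 * \<gamma>" by (simp add: \<mu>_def one_pCons[symmetric])
  finally show ?thesis .
qed

section \<open>Graphs and the characteristic matrix of the signless Laplacian\<close>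

text \<open>The entry of \<xi> I - Q(X) at a pair of vertices, independent of any enumeration. On
  the diagonal the second term asks for the loop \<open>{x}\<close>, which a simple graph does not
  have.\<close>

definition lap_kernel :: "'a ugraph \<Rightarrow> 'a \<Rightarrow> 'a \<Rightarrow> complex poly" where
  "lap_kernel X x y = (if x = y then \<xi> - of_nat (degree_of X x) else 0)
    - (if {x, y} \<in> edges X then 1 else 0)"

lemma det_lap_kernel:
  assumes "distinct vs"
  shows "det (list_mat (lap_kernel X) vs vs) = char_poly (signless_laplacian vs X)"
proof -
  have "char_poly_matrix (signless_laplacian vs X) = list_mat (lap_kernel X) vs vs"
    using assms
    by (intro eq_matI)
      (auto simp: char_poly_matrix_def signless_laplacian_def degree_mat_def adjacency_mat_def
        lap_kernel_def nth_eq_iff_index_eq of_nat_poly one_pCons)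
  then show ?thesis by (simp add: char_poly_def)
qed

lemma spectrum_Q_lap_kernel:
  assumes "distinct vs" "set vs = verts X"
  shows "\<sigma> (Q X) = proots (det (list_mat (lap_kernel X) vs vs))"
  using spectrum_Q_enum[OF assms] det_lap_kernel[OF assms(1)] by (simp add: spectrum_def)

text \<open>Characteristic polynomials are monic. Being nonzero is what allows the roots of a
  product to be split into the roots of its factors.\<close>

lemma det_lap_kernel_nonzero:
  assumes "distinct vs"
  shows "det (list_mat (lap_kernel X) vs vs) \<noteq> 0"
proof -
  have "signless_laplacian vs X \<in> carrier_mat (length vs) (length vs)"
    by (simp add: signless_laplacian_def degree_mat_def adjacency_mat_def)
  from degree_monic_char_poly[OF this] show ?thesis
    using det_lap_kernel[OF assms, of X] by (metis coeff_0 zero_neq_one)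
qed

lemma simple_graph_no_loop: "simple_graph X \<Longrightarrow> {x} \<notin> edges X"
  by (auto simp: simple_graph_def)

lemma simple_graph_edgeD:
  assumes "simple_graph X" "{x, y} \<in> edges X"
  shows "x \<in> verts X" "y \<in> verts X" "x \<noteq> y"
  using assms by (auto simp: simple_graph_def dest!: bspec)

lemma dominating_vertex:
  assumes X: "simple_graph X" and "degree_of X x = order_of X - 1" "x \<in> verts X" "y \<in> verts X" "y \<noteq> x"
  shows "{x, y} \<in> edges X"
proof -
  have fin: "finite (verts X)" using X by (simp add: simple_graph_def)
  have "{y \<in> verts X. {x, y} \<in> edges X} = verts X - {x}"
    using assms fin simple_graph_no_loop[OF X, of x]
    by (intro card_subset_eq) (auto simp: degree_of_def order_of_def)
  with assms show ?thesis by blast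
qed

text \<open>An edge is a doubleton that may be listed in either order, so preimages can be chosen in
  the order that matches \<open>p\<close> and \<open>q\<close>.\<close>

lemma doubleton_mem_image_edges:
  assumes "simple_graph X"
  shows "{p, q} \<in> (`) f ` edges X \<longleftrightarrow> (\<exists>x y. {x, y} \<in> edges X \<and> p = f x \<and> q = f y)"
proof
  assume "{p, q} \<in> (`) f ` edges X"
  then obtain d where d: "d \<in> edges X" "{p, q} = f ` d" by auto
  with assms obtain x y where "d = {x, y}" by (auto simp: simple_graph_def card_2_iff)
  with d have "{x, y} \<in> edges X" "{y, x} \<in> edges X" "{p, q} = {f x, f y}"
    by (auto simp: insert_commute)
  then show "\<exists>x y. {x, y} \<in> edges X \<and> p = f x \<and> q = f y"
    unfolding doubleton_eq_iff by blast
next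
  assume "\<exists>x y. {x, y} \<in> edges X \<and> p = f x \<and> q = f y"
  then obtain x y where "{x, y} \<in> edges X" "{p, q} = f ` {x, y}" by auto
  then show "{p, q} \<in> (`) f ` edges X" by blast
qed

section \<open>The graph to be pasted\<close>

locale dominated_edge =
  fixes H :: "'b ugraph" and u v :: 'b and r :: nat
  assumes H: "simple_graph H" and uv: "{u, v} \<in> edges H"
    and deg_u: "degree_of H u = order_of H - 1" and deg_v: "degree_of H v = order_of H - 1"
    and reg: "regular (delete_verts H {u, v}) r"
begin

definition W :: "'b set" where "W = verts H - {u, v}"

definition s :: "complex poly" where "s = \<xi> - 2 * of_nat r - 2"

text \<open>
  The entries of \<open>\<xi> I - (Q(H\<^sub>2) + 2 I)\<close>, the block of the characteristic matrix that belongs to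
  \<open>W\<close>, both in \<open>H\<close> and in each of its copies in the graph with edge-pockets. Its row sums are \<open>s\<close>.
\<close>

definition L :: "'b \<Rightarrow> 'b \<Rightarrow> complex poly" where
  "L w w' = (if w = w' then \<xi> - of_nat (r + 2) else 0) - (if {w, w'} \<in> edges H then 1 else 0)"

lemma uv_verts: "u \<in> verts H" "v \<in> verts H" "u \<noteq> v"
  using simple_graph_edgeD[OF H uv] by auto

lemma finite_W: "finite W"
  using H by (simp add: W_def simple_graph_def)

lemma order_H: "order_of H = card W + 2"
proof -
  have "verts H = insert u (insert v W)" "u \<notin> W" "v \<notin> W" using uv_verts by (auto simp: W_def)
  then show ?thesis using uv_verts finite_W by (simp add: order_of_def)
qed

lemma edge_ends:
  assumes "w \<in> W"
  shows "{u, w} \<in> edges H" "{w, u} \<in> edges H" "{v, w} \<in> edges H" "{w, v} \<in> edges H"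
  using assms dominating_vertex[OF H deg_u uv_verts(1), of w]
    dominating_vertex[OF H deg_v uv_verts(2), of w]
  by (auto simp: W_def insert_commute)

lemma card_W_neighbours:
  assumes "w \<in> W"
  shows "card {w' \<in> W. {w, w'} \<in> edges H} = r"
proof -
  have "degree_of (delete_verts H {u, v}) w = r"
    using reg assms by (simp add: regular_def delete_verts_def W_def)
  moreover have "{y \<in> verts H - {u, v}. {w, y} \<in> edges H \<and> {w, y} \<inter> {u, v} = {}} =
      {w' \<in> W. {w, w'} \<in> edges H}"
    using assms by (auto simp: W_def)
  ultimately show ?thesis by (simp add: degree_of_def delete_verts_def)
qed

text \<open>The summand 2 counts \<open>u\<close> and \<open>v\<close>, which are joined to every
  vertex of \<open>W\<close>.\<close>

lemma degree_W:
  assumes "w \<in> W"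
  shows "degree_of H w = r + 2"
proof -
  have "{y \<in> verts H. {w, y} \<in> edges H} = insert u (insert v {w' \<in> W. {w, w'} \<in> edges H})"
    using uv_verts edge_ends[OF assms] by (auto simp: W_def)
  moreover have "u \<notin> W" "v \<notin> W" by (auto simp: W_def)
  ultimately show ?thesis
    using card_W_neighbours[OF assms] finite_W uv_verts by (simp add: degree_of_def)
qed

text \<open>The diagonal contributes \<open>\<xi> - (r + 2)\<close> and each of the \<open>r\<close>
  neighbours inside \<open>W\<close> contributes -1.\<close>

lemma sum_L:
  assumes "w \<in> W"
  shows "(\<Sum>w'\<in>W. L w w') = s"
proof -
  have "(\<Sum>w'\<in>W. L w w') = (\<Sum>w'\<in>W. if w = w' then \<xi> - of_nat (r + 2) else 0) -
      (\<Sum>w'\<in>W. if {w, w'} \<in> edges H then 1 else 0)"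
    by (simp add: L_def sum_subtractf)
  also have "(\<Sum>w'\<in>W. if {w, w'} \<in> edges H then 1 else 0) = (of_nat r :: complex poly)"
    using finite_W card_W_neighbours[OF assms] by (simp add: sum.If_cases Int_def)
  finally show ?thesis using finite_W assms by (simp add: s_def algebra_simps)
qed

context
  fixes ws
  assumes ws: "distinct ws" "set ws = W"
begin

text \<open>All row sums equal \<open>s\<close>, which vanishes at this point. This is the
  divisibility of \<phi> by \<open>s\<close>.\<close>

lemma root_det_L:
  assumes "W \<noteq> {}"
  shows "poly (det (list_mat L ws ws)) (2 * of_nat r + 2) = 0"
proof (rule root_det_list_mat)
  fix w assume "w \<in> set ws"
  then have "(\<Sum>z\<leftarrow>ws. poly (L w z) (2 * of_nat r + 2)) = poly s (2 * of_nat r + 2)"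
    using ws sum_L[of w] by (simp add: sum_list_distinct_conv_sum_set flip: poly_sum)
  then show "(\<Sum>z\<leftarrow>ws. poly (L w z) (2 * of_nat r + 2)) = 0"
    by (simp add: s_def)
qed (use assms ws in auto)

text \<open>Schur complement over \<open>W\<close>: each column from \<open>W\<close> to
  \<open>u\<close> or \<open>v\<close> is constant -1, so the block of \<open>W\<close> multiplies
  it by its row sum \<open>s\<close>. The factor \<open>s ^ 2\<close> comes from the two remaining
  vertices.\<close>

lemma det_lap_kernel_H:
  "det (list_mat (lap_kernel H) ([u, v] @ ws) ([u, v] @ ws)) * s ^ 2 =
    s * (\<xi> - of_nat (card W)) * (s * (\<xi> - of_nat (card W + 2)) - 2 * of_nat (card W)) *
    det (list_mat L ws ws)"
proof -
  let ?K = "lap_kernel H"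
  have nW: "u \<notin> W" "v \<notin> W" by (auto simp: W_def)
  have K: "?K w w' = L w w'" if "w \<in> W" "w' \<in> W" for w w'
    using that by (simp add: lap_kernel_def L_def degree_W)
  have Ku: "?K w x = -1" "?K x w = -1" if "w \<in> W" "x \<in> {u, v}" for w x
    using that nW edge_ends[OF that(1)] by (auto simp: lap_kernel_def)
  have uv': "?K u u = \<xi> - of_nat (card W + 1)" "?K v v = \<xi> - of_nat (card W + 1)"
    "?K u v = -1" "?K v u = -1"
    using uv uv_verts deg_u deg_v simple_graph_no_loop[OF H] order_H
    by (simp_all add: lap_kernel_def insert_commute)
  have "(\<Sum>z\<leftarrow>ws. ?K y z * ?K z x) = s * ?K y x" if "y \<in> set ws" "x \<in> set [u, v]" for y x
  proof -
    have "(\<Sum>z\<leftarrow>ws. ?K y z * ?K z x) = (\<Sum>z\<in>W. L y z * (- 1))"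
      unfolding sum_list_distinct_conv_sum_set[OF ws(1)] ws(2)
      using that ws K Ku by (intro sum.cong) auto
    also have "\<dots> = - s" using that ws sum_L[of y] by (simp add: sum_negf)
    finally show ?thesis using that ws Ku by simp
  qed
  note schur = det_list_mat_schur[where K = ?K and xs = "[u, v]" and ys = ws and s = s, OF this]
  have sum: "(\<Sum>z\<leftarrow>ws. ?K x z * ?K z x') = of_nat (card W)" if "x \<in> {u, v}" "x' \<in> {u, v}" for x x'
  proof -
    have "(\<Sum>z\<leftarrow>ws. ?K x z * ?K z x') = (\<Sum>z\<in>W. 1)"
      unfolding sum_list_distinct_conv_sum_set[OF ws(1)] ws(2)
      using that ws Ku by (intro sum.cong) auto
    then show ?thesis by simp
  qed
  have "list_mat ?K ws ws = list_mat L ws ws" using ws K by (intro list_mat_cong) auto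
  \<comment> \<open>With \<open>c = card W\<close> the Schur complement has equal diagonal and equal
    off-diagonal entries, and its determinant factors as a difference of squares.\<close>
  moreover have "(s * (x - (c + 1)) - c) * (s * (x - (c + 1)) - c) - (s * (- 1) - c) * (s * (- 1) - c) =
      s * (x - c) * (s * (x - (c + 2)) - 2 * c)" for x c :: "complex poly"
    by (simp add: algebra_simps)
  ultimately show ?thesis
    using schur by (simp only: det_list_mat_pair sum uv' insertI1 insertI2 insert_iff simp_thms
        of_nat_add of_nat_1 of_nat_numeral list.size One_nat_def[symmetric] add_0 one_add_one)
qed

end

lemma proots_s: "proots s = {#2 * of_nat r + 2#}"
proof -
  have "s = [:- (2 * of_nat r + 2), 1:]" by (simp add: s_def of_nat_poly numeral_poly)
  then show ?thesis by (simp only: proots_linear_factor minus_minus)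
qed

lemma s_nonzero: "s \<noteq> 0"
  using proots_s by auto

text \<open>Root multisets are compared in \<open>det_lap_kernel_H\<close>. The three removed values
  turn out to be a submultiset of the spectrum, so the multiset difference truncates
  nothing.\<close>

lemma spectrum_H:
  fixes ws
  assumes ws: "distinct ws" "set ws = W" and W: "W \<noteq> {}"
    and roots: "proots (s * (\<xi> - of_nat (order_of H)) - 2 * (of_nat (order_of H) - 2)) = {#\<zeta>, \<eta>#}"
  shows "add_mset (2 * of_nat r + 2) (\<sigma> (Q H) - {#of_nat (order_of H) - 2, \<zeta>, \<eta>#}) =
      proots (det (list_mat L ws ws))" (is "?l = proots ?\<phi>")
proof -
  let ?D = "det (list_mat (lap_kernel H) ([u, v] @ ws) ([u, v] @ ws))"
  let ?p = "s * (\<xi> - of_nat (order_of H)) - 2 * (of_nat (order_of H) - 2)"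
  have c: "of_nat (order_of H) - 2 = (of_nat (card W) :: complex)"
    "of_nat (order_of H) - 2 = (of_nat (card W) :: complex poly)"
    by (simp_all add: order_H)
  have lin: "proots (\<xi> - of_nat k) = {#of_nat k#}" for k
    using proots_linear_factor[of "- of_nat k"] by (simp add: of_nat_poly)
  have vs: "distinct ([u, v] @ ws)" "set ([u, v] @ ws) = verts H"
    using ws uv_verts by (auto simp: W_def)
  have D: "?D * s ^ 2 = s * (\<xi> - of_nat (card W)) * ?p * ?\<phi>"
    using det_lap_kernel_H[OF ws] by (simp add: c order_H)
  have "?D * s ^ 2 \<noteq> 0" using det_lap_kernel_nonzero[OF vs(1), of H] s_nonzero by simp
  then have nz: "\<xi> - of_nat (card W) \<noteq> 0" "?p \<noteq> 0" "?\<phi> \<noteq> 0" unfolding D by auto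
  have "proots (?D * s ^ 2) = proots ?D + repeat_mset 2 (proots s)"
    using det_lap_kernel_nonzero[OF vs(1), of H] s_nonzero
    by (simp add: proots_mult proots_power del: append.simps)
  moreover have "proots (s * (\<xi> - of_nat (card W)) * ?p * ?\<phi>) =
      proots s + proots (\<xi> - of_nat (card W)) + proots ?p + proots ?\<phi>"
    using nz s_nonzero by (simp only: proots_mult mult_eq_0_iff simp_thms)
  ultimately have "proots ?D + {#2 * of_nat r + 2, 2 * of_nat r + 2#} =
      {#2 * of_nat r + 2#} + {#of_nat (card W)#} + {#\<zeta>, \<eta>#} + proots ?\<phi>"
    unfolding D roots lin proots_s by (simp add: numeral_2_eq_2)
  \<comment> \<open>The left side has this root twice from \<open>s ^ 2\<close>, while the factor
    \<open>s\<close> on the right supplies it once; the second copy is taken from \<phi>.\<close>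
  moreover have "2 * of_nat r + 2 \<in># proots ?\<phi>"
    using root_det_L[OF ws W] nz by simp
  then obtain P where P: "proots ?\<phi> = add_mset (2 * of_nat r + 2) P"
    by (metis insert_DiffM)
  ultimately have "proots ?D = {#of_nat (card W), \<zeta>, \<eta>#} + P" by simp
  then have "\<sigma> (Q H) = {#of_nat (card W), \<zeta>, \<eta>#} + P"
    using spectrum_Q_lap_kernel[OF vs] by simp
  then have "\<sigma> (Q H) - {#of_nat (card W), \<zeta>, \<eta>#} = P" by simp
  with P show "?l = proots ?\<phi>" unfolding c by simp
qed

end

section \<open>The graph with edge-pockets\<close>

locale edge_pocket_graph = dominated_edge H u v r
  for H :: "'b ugraph" and u v r +
  fixes F :: "'a ugraph" and E :: "'a set set" and a b :: "'a set \<Rightarrow> 'a"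
  assumes F: "simple_graph F" and EF: "E \<subseteq> edges F" and ab: "\<And>e. e \<in> E \<Longrightarrow> e = {a e, b e}"
begin

abbreviation G :: "('a + 'a set \<times> 'b) ugraph" where "G \<equiv> edge_pockets F E a b H u v"

abbreviation f :: "'a set \<Rightarrow> 'b \<Rightarrow> 'a + 'a set \<times> 'b" where "f \<equiv> pocket_map a b u v"

lemma ab_edge:
  assumes "e \<in> E"
  shows "{a e, b e} \<in> edges F"
  using assms EF by (subst ab[OF assms, symmetric]) auto

lemma mem_edge: "e \<in> E \<Longrightarrow> x \<in> e \<longleftrightarrow> x = a e \<or> x = b e"
  using ab by blast

lemma ab_verts: "e \<in> E \<Longrightarrow> a e \<in> verts F" "e \<in> E \<Longrightarrow> b e \<in> verts F" "e \<in> E \<Longrightarrow> a e \<noteq> b e"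
  using simple_graph_edgeD[OF F ab_edge] by auto

lemma mem_E_verts: "e \<in> E \<Longrightarrow> x \<in> e \<Longrightarrow> x \<in> verts F"
  by (auto simp: mem_edge ab_verts)

lemma finite_E: "finite E"
proof -
  have "E \<subseteq> Pow (verts F)" using mem_E_verts by auto
  then show ?thesis using F by (auto simp: simple_graph_def intro: finite_subset)
qed

lemma f_simps:
  "f e u = Inl (a e)" "f e v = Inl (b e)" "w \<in> W \<Longrightarrow> f e w = Inr (e, w)"
  using uv_verts by (auto simp: pocket_map_def W_def)

lemma f_eq_Inl: "f e w = Inl x \<longleftrightarrow> w = u \<and> x = a e \<or> w = v \<and> x = b e"
  using uv_verts by (auto simp: pocket_map_def)

lemma f_eq_Inr: "f e w = Inr (e', w') \<longleftrightarrow> w \<noteq> u \<and> w \<noteq> v \<and> e' = e \<and> w' = w"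
  by (auto simp: pocket_map_def)

lemma verts_H: "verts H = insert u (insert v W)"
  using uv_verts by (auto simp: W_def)

lemma verts_G: "verts G = Inl ` verts F \<union> Inr ` (E \<times> W)"
proof -
  have "f e ` verts H = {Inl (a e), Inl (b e)} \<union> Inr ` ({e} \<times> W)" for e
    unfolding verts_H by (auto simp: f_simps)
  then show ?thesis using ab_verts by (auto simp: edge_pockets_def)
qed

lemma mem_edges_G:
  "{p, q} \<in> edges G \<longleftrightarrow> (\<exists>x y. {x, y} \<in> edges F \<and> p = Inl x \<and> q = Inl y) \<or>
    (\<exists>e\<in>E. \<exists>w w'. {w, w'} \<in> edges H \<and> p = f e w \<and> q = f e w')"
  by (simp add: edge_pockets_def doubleton_mem_image_edges[OF F] doubleton_mem_image_edges[OF H])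

text \<open>Pasting adds no edge inside \<open>F\<close>: an edge of a copy with both ends in
  \<open>F\<close> is the image of \<open>uv\<close>, which is the edge \<open>e\<close>
  itself.\<close>

lemma edges_Inl_Inl: "{Inl x, Inl y} \<in> edges G \<longleftrightarrow> {x, y} \<in> edges F"
proof
  assume "{Inl x, Inl y} \<in> edges G"
  then consider "{x, y} \<in> edges F" | e w w' where "e \<in> E" "{w, w'} \<in> edges H" "Inl x = f e w" "Inl y = f e w'"
    unfolding mem_edges_G by auto
  then show "{x, y} \<in> edges F"
  proof cases
    case 2
    then have "{x, y} = {a e, b e}"
      using simple_graph_edgeD[OF H 2(2)] f_eq_Inl[of e w x] f_eq_Inl[of e w' y] by auto
    with ab_edge[OF 2(1)] show ?thesis by simp
  qed
qed (auto simp: mem_edges_G)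

text \<open>\<open>u\<close> and \<open>v\<close> are joined to all of \<open>W\<close>, so both
  ends of \<open>e\<close> are adjacent to the whole interior of its pocket.\<close>

lemma edges_Inl_Inr: "{Inl x, Inr (e, w)} \<in> edges G \<longleftrightarrow> e \<in> E \<and> x \<in> e \<and> w \<in> W"
proof
  assume "{Inl x, Inr (e, w)} \<in> edges G"
  then obtain e' z w' where e': "e' \<in> E" "{z, w'} \<in> edges H" "f e' z = Inl x" "f e' w' = Inr (e, w)"
    unfolding mem_edges_G by (metis Inl_Inr_False)
  then have "w \<in> W" "e' = e" using simple_graph_edgeD[OF H e'(2)] by (auto simp: f_eq_Inr W_def)
  moreover have "x \<in> e'" using e'(3) by (auto simp: f_eq_Inl mem_edge[OF e'(1)])
  ultimately show "e \<in> E \<and> x \<in> e \<and> w \<in> W" using e'(1) by simp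
next
  assume *: "e \<in> E \<and> x \<in> e \<and> w \<in> W"
  then have "x = a e \<or> x = b e" using mem_edge[of e x] by blast
  then obtain z where "Inl x = f e z" "{z, w} \<in> edges H"
    using f_simps(1,2)[of e] edge_ends(1,3)[of w] * by metis
  moreover have "e \<in> E" "Inr (e, w) = f e w" using * by (auto simp: f_simps)
  ultimately show "{Inl x, Inr (e, w)} \<in> edges G" unfolding mem_edges_G by blast
qed

lemma edges_Inr_Inl: "{Inr (e, w), Inl x} \<in> edges G \<longleftrightarrow> e \<in> E \<and> x \<in> e \<and> w \<in> W"
  using edges_Inl_Inr by (simp add: insert_commute)

lemma edges_Inr_Inr:
  "{Inr (e, w), Inr (e', w')} \<in> edges G \<longleftrightarrow>
    e = e' \<and> e \<in> E \<and> w \<in> W \<and> w' \<in> W \<and> {w, w'} \<in> edges H"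
proof
  assume "{Inr (e, w), Inr (e', w')} \<in> edges G"
  then obtain d y z where d: "d \<in> E" "{y, z} \<in> edges H" "f d y = Inr (e, w)" "f d z = Inr (e', w')"
    unfolding mem_edges_G by (metis Inr_Inl_False)
  with simple_graph_edgeD[OF H d(2)]
  show "e = e' \<and> e \<in> E \<and> w \<in> W \<and> w' \<in> W \<and> {w, w'} \<in> edges H"
    by (auto simp: f_eq_Inr W_def)
next
  assume "e = e' \<and> e \<in> E \<and> w \<in> W \<and> w' \<in> W \<and> {w, w'} \<in> edges H"
  then have "e \<in> E" "{w, w'} \<in> edges H" "Inr (e, w) = f e w" "Inr (e', w') = f e w'"
    by (auto simp: f_simps)
  then show "{Inr (e, w), Inr (e', w')} \<in> edges G" unfolding mem_edges_G by blast
qed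

text \<open>Each pocket at \<open>x\<close> adds its whole interior as neighbours; the other end of
  its edge is already counted in \<open>F\<close>.\<close>

lemma degree_Inl: "degree_of G (Inl x) = degree_of F x + card {e \<in> E. x \<in> e} * card W"
proof -
  have "{y \<in> verts G. {Inl x, y} \<in> edges G} =
      Inl ` {y \<in> verts F. {x, y} \<in> edges F} \<union> Inr ` ({e \<in> E. x \<in> e} \<times> W)"
    unfolding verts_G by (auto simp: edges_Inl_Inl edges_Inl_Inr)
  moreover have "card (Inl ` {y \<in> verts F. {x, y} \<in> edges F} \<union> Inr ` ({e \<in> E. x \<in> e} \<times> W)) =
      card (Inl ` {y \<in> verts F. {x, y} \<in> edges F} :: ('a + 'a set \<times> 'b) set) +
      card (Inr ` ({e \<in> E. x \<in> e} \<times> W) :: ('a + 'a set \<times> 'b) set)"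
    using F finite_E finite_W by (intro card_Un_disjoint) (auto simp: simple_graph_def)
  ultimately show ?thesis
    by (simp add: degree_of_def card_image card_cartesian_product)
qed

text \<open>The neighbours are the two ends of \<open>e\<close> and \<open>r\<close> vertices in the
  same pocket, as in \<open>H\<close>; hence the diagonal entries of \<open>L\<close> serve for
  every pocket.\<close>

lemma degree_Inr:
  assumes "e \<in> E" "w \<in> W"
  shows "degree_of G (Inr (e, w)) = r + 2"
proof -
  have "{y \<in> verts G. {Inr (e, w), y} \<in> edges G} =
      Inl ` {a e, b e} \<union> (\<lambda>w'. Inr (e, w')) ` {w' \<in> W. {w, w'} \<in> edges H}"
    unfolding verts_G using assms ab_verts[OF assms(1)]
    by (auto simp: edges_Inr_Inl edges_Inr_Inr mem_edge)
  moreover have "card (Inl ` {a e, b e} \<union> (\<lambda>w'. Inr (e, w')) ` {w' \<in> W. {w, w'} \<in> edges H}) =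
      card (Inl ` {a e, b e} :: ('a + 'a set \<times> 'b) set) +
      card ((\<lambda>w'. Inr (e, w') :: 'a + 'a set \<times> 'b) ` {w' \<in> W. {w, w'} \<in> edges H})"
    using finite_W by (intro card_Un_disjoint) auto
  moreover have "card (Inl ` {a e, b e} :: ('a + 'a set \<times> 'b) set) = 2"
    using ab_verts(3)[OF assms(1)] by (simp add: card_image)
  moreover have "card ((\<lambda>w'. Inr (e, w') :: 'a + 'a set \<times> 'b) ` {w' \<in> W. {w, w'} \<in> edges H}) = r"
    using card_W_neighbours[OF assms(2)] by (simp add: card_image inj_on_def)
  ultimately show ?thesis by (simp add: degree_of_def)
qed

context
  fixes xs :: "'a list" and es :: "'a set list" and ws :: "'b list"
  assumes xs: "distinct xs" "set xs = verts F" and es: "distinct es" "set es = E"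
    and ws: "distinct ws" "set ws = W"
begin

text \<open>Interior vertices are listed pocket by pocket, which makes their block of the
  characteristic matrix block diagonal.\<close>

definition ps :: "('a + 'a set \<times> 'b) list" where
  "ps = concat (map (\<lambda>e. map (\<lambda>w. Inr (e, w)) ws) es)"

lemma sum_list_ps:
  fixes g :: "_ \<Rightarrow> 'r :: comm_monoid_add"
  shows "(\<Sum>z\<leftarrow>ps. g z) = (\<Sum>e\<in>E. \<Sum>w\<in>W. g (Inr (e, w)))"
proof -
  have "(\<Sum>z\<leftarrow>concat (map (\<lambda>e. map (\<lambda>w. Inr (e, w)) ws) ds). g z) =
      (\<Sum>e\<leftarrow>ds. \<Sum>w\<in>W. g (Inr (e, w)))" for ds
    using ws by (induction ds) (simp_all add: o_def sum_list_distinct_conv_sum_set)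
  then show ?thesis using es by (simp add: ps_def sum_list_distinct_conv_sum_set)
qed

lemma distinct_vertex_list: "distinct (map Inl xs @ ps)" "set (map Inl xs @ ps) = verts G"
proof -
  have "distinct (concat (map (\<lambda>e. map (\<lambda>w. Inr (e, w) :: 'a + 'a set \<times> 'b) ws) ds))"
    if "distinct ds" for ds
    using that ws by (induction ds) (auto simp: distinct_map inj_on_def)
  then show "distinct (map Inl xs @ ps)"
    using xs es by (auto simp: ps_def distinct_map)
  show "set (map Inl xs @ ps) = verts G"
    using xs es ws unfolding verts_G by (auto simp: ps_def)
qed

lemma lap_kernel_G:
  "x \<in> verts F \<Longrightarrow> e \<in> E \<Longrightarrow> w \<in> W \<Longrightarrow> lap_kernel G (Inl x) (Inr (e, w)) = (if x \<in> e then -1 else 0)"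
  "x \<in> verts F \<Longrightarrow> e \<in> E \<Longrightarrow> w \<in> W \<Longrightarrow> lap_kernel G (Inr (e, w)) (Inl x) = (if x \<in> e then -1 else 0)"
  "e \<in> E \<Longrightarrow> w \<in> W \<Longrightarrow> e' \<in> E \<Longrightarrow> w' \<in> W \<Longrightarrow>
    lap_kernel G (Inr (e, w)) (Inr (e', w')) = (if e = e' then L w w' else 0)"
  by (auto simp: lap_kernel_def edges_Inl_Inr edges_Inr_Inl edges_Inr_Inr degree_Inr L_def)

text \<open>Schur complement over the interiors. The column of \<open>x\<close> is constant on each
  pocket, -1 if \<open>x\<close> lies on its edge and 0 otherwise, so the interior block multiplies
  it by \<open>s\<close>. The correction at \<open>x\<close>, \<open>y\<close> counts the interior
  vertices adjacent to both: \<open>card W\<close> for each edge of \<open>E\<close> containing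
  \<open>x\<close> and \<open>y\<close>.\<close>

lemma det_lap_kernel_G:
  "det (list_mat (lap_kernel G) (map Inl xs @ ps) (map Inl xs @ ps)) * s ^ card (verts F) =
    det (list_mat (\<lambda>x y. s * lap_kernel G (Inl x) (Inl y) -
      of_nat (card W) * of_nat (card {e \<in> E. x \<in> e \<and> y \<in> e})) xs xs) *
    det (list_mat L ws ws) ^ card E"
proof -
  let ?K = "lap_kernel G"
  have "(\<Sum>z\<leftarrow>ps. ?K y z * ?K z x) = s * ?K y x" if y: "y \<in> set ps" and x: "x \<in> set (map Inl xs)" for y x
  proof -
    obtain e w where e: "y = Inr (e, w)" "e \<in> E" "w \<in> W" using y es ws by (auto simp: ps_def)
    obtain x' where x': "x = Inl x'" "x' \<in> verts F" using x xs by auto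
    \<comment> \<open>Only the pocket containing \<open>y\<close> contributes, and on it
      \<open>z\<close> ranges over a row of \<open>L\<close>.\<close>
    have "(\<Sum>z\<leftarrow>ps. ?K y z * ?K z x) =
        (\<Sum>e'\<in>E. \<Sum>w'\<in>W. if e = e' then L w w' * (if x' \<in> e then -1 else 0) else 0)"
      unfolding sum_list_ps e(1) x'(1)
      by (intro sum.cong refl) (use e x' in \<open>auto simp: lap_kernel_G\<close>)
    also have "\<dots> = (\<Sum>e'\<in>E. if e = e' then \<Sum>w'\<in>W. L w w' * (if x' \<in> e then -1 else 0) else 0)"
      by (intro sum.cong) auto
    also have "\<dots> = (\<Sum>w'\<in>W. L w w') * (if x' \<in> e then -1 else 0)"
      using e finite_E by (simp add: sum_distrib_right)
    also have "\<dots> = s * ?K y x"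
      using e x' by (simp add: sum_L lap_kernel_G)
    finally show ?thesis .
  qed
  note schur = det_list_mat_schur[where K = ?K and xs = "map Inl xs" and ys = ps and s = s, OF this]
  have "(\<Sum>z\<leftarrow>ps. ?K (Inl x) z * ?K z (Inl y)) =
      of_nat (card W) * of_nat (card {e \<in> E. x \<in> e \<and> y \<in> e})" if "x \<in> set xs" "y \<in> set xs" for x y
  proof -
    have "(\<Sum>z\<leftarrow>ps. ?K (Inl x) z * ?K z (Inl y)) =
        (\<Sum>e\<in>E. \<Sum>w\<in>W. if x \<in> e \<and> y \<in> e then 1 else 0)"
      unfolding sum_list_ps
      by (intro sum.cong refl) (use that xs in \<open>auto simp: lap_kernel_G\<close>)
    also have "\<dots> = of_nat (card W) * (\<Sum>e\<in>E. if x \<in> e \<and> y \<in> e then 1 else 0)"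
      by (simp add: sum_distrib_left if_distrib cong: if_cong)
    also have "(\<Sum>e\<in>E. if x \<in> e \<and> y \<in> e then 1 else 0) = (of_nat (card {e \<in> E. x \<in> e \<and> y \<in> e}) :: complex poly)"
      using finite_E by (simp add: sum.If_cases Int_def)
    finally show ?thesis .
  qed
  then have "list_mat (\<lambda>x x'. s * ?K x x' - (\<Sum>z\<leftarrow>ps. ?K x z * ?K z x')) (map Inl xs) (map Inl xs) =
      list_mat (\<lambda>x y. s * ?K (Inl x) (Inl y) -
        of_nat (card W) * of_nat (card {e \<in> E. x \<in> e \<and> y \<in> e})) xs xs"
    unfolding list_mat_map by (intro list_mat_cong) simp
  moreover have "det (list_mat ?K ps ps) = det (list_mat L ws ws) ^ length es"
    unfolding ps_def by (rule det_list_mat_copies) (use es ws in \<open>auto simp: lap_kernel_G\<close>)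
  moreover have "length es = card E" "length (map Inl xs) = card (verts F)"
    using es xs distinct_card by (metis, metis length_map)
  ultimately show ?thesis using schur by simp
qed

end

end

section \<open>Complete graphs and cycles\<close>

lemma complete_graph_iso:
  assumes F: "simple_graph F" and iso: "graph_iso F (complete_graph n)"
  shows "card (verts F) = n"
    and "x \<in> verts F \<Longrightarrow> y \<in> verts F \<Longrightarrow> {x, y} \<in> edges F \<longleftrightarrow> x \<noteq> y"
    and "x \<in> verts F \<Longrightarrow> degree_of F x = n - 1"
proof -
  obtain g where g: "bij_betw g (verts F) {0..<n}"
    and e: "\<And>x y. x \<in> verts F \<Longrightarrow> y \<in> verts F \<Longrightarrow>
      {x, y} \<in> edges F \<longleftrightarrow> {g x, g y} \<in> edges (complete_graph n)"
    using iso by (auto simp: graph_iso_def complete_graph_def)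
  show n: "card (verts F) = n" using bij_betw_same_card[OF g] by simp
  have adj: "{x, y} \<in> edges F \<longleftrightarrow> x \<noteq> y" if "x \<in> verts F" "y \<in> verts F" for x y
  proof -
    have "g x < n" "g y < n" using that bij_betwE[OF g] by auto
    then have "{g x, g y} \<in> edges (complete_graph n) \<longleftrightarrow> g x \<noteq> g y"
      by (auto simp: complete_graph_def doubleton_eq_iff)
    also have "\<dots> \<longleftrightarrow> x \<noteq> y" using that g by (auto simp: bij_betw_def inj_on_eq_iff)
    finally show ?thesis using e[OF that] by simp
  qed
  then show "x \<in> verts F \<Longrightarrow> y \<in> verts F \<Longrightarrow> {x, y} \<in> edges F \<longleftrightarrow> x \<noteq> y" .
  show "degree_of F x = n - 1" if "x \<in> verts F"
  proof -
    have "{y \<in> verts F. {x, y} \<in> edges F} = verts F - {x}" using adj[OF that] by auto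
    with that n F show ?thesis by (simp add: degree_of_def simple_graph_def)
  qed
qed

lemma mem_cycle_graph:
  assumes "i < n" "j < n"
  shows "{i, j} \<in> edges (cycle_graph n) \<longleftrightarrow> j = (i + 1) mod n \<or> i = (j + 1) mod n"
proof -
  have "{i, j} \<in> edges (cycle_graph n) \<longleftrightarrow> (\<exists>k<n. {i, j} = {k, (k + 1) mod n})"
    unfolding cycle_graph_def by (simp only: ugraph.simps) blast
  then show ?thesis unfolding doubleton_eq_iff using assms by blast
qed

text \<open>The inverse isomorphism lists the vertices in cyclic order, which is the order that
  makes the matrix of the theorem circulant.\<close>

lemma cycle_graph_iso:
  assumes "graph_iso X (cycle_graph n)"
  obtains xs where "distinct xs" "set xs = verts X" "length xs = n"
    "\<And>i j. i < n \<Longrightarrow> j < n \<Longrightarrow>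
      {xs ! i, xs ! j} \<in> edges X \<longleftrightarrow> j = (i + 1) mod n \<or> i = (j + 1) mod n"
proof -
  obtain g where g: "bij_betw g (verts X) {0..<n}"
    and e: "\<And>x y. x \<in> verts X \<Longrightarrow> y \<in> verts X \<Longrightarrow>
      {x, y} \<in> edges X \<longleftrightarrow> {g x, g y} \<in> edges (cycle_graph n)"
    using assms by (auto simp: graph_iso_def cycle_graph_def)
  define h where "h = inv_into (verts X) g"
  have h: "bij_betw h {0..<n} (verts X)" unfolding h_def by (rule bij_betw_inv_into[OF g])
  have gh: "g (h i) = i" "h i \<in> verts X" if "i < n" for i
    using that bij_betw_inv_into_right[OF g, of i] bij_betwE[OF h] by (auto simp: h_def)
  show ?thesis
  proof (rule that[of "map h [0..<n]"])
    show "distinct (map h [0..<n])" "set (map h [0..<n]) = verts X" "length (map h [0..<n]) = n"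
      using h by (auto simp: distinct_map bij_betw_def)
    fix i j assume "i < n" "j < n"
    then show "{map h [0..<n] ! i, map h [0..<n] ! j} \<in> edges X \<longleftrightarrow>
        j = (i + 1) mod n \<or> i = (j + 1) mod n"
      using e[OF gh(2) gh(2), of i j] gh(1) mem_cycle_graph[of i n j] by simp
  qed
qed

text \<open>An edge containing two distinct vertices consists of exactly these. The count is the
  adjacency part of the correction term in the Schur complement.\<close>

lemma card_edges_at_two:
  assumes X: "simple_graph X" and "x \<noteq> y"
  shows "card {e \<in> edges X. x \<in> e \<and> y \<in> e} = (if {x, y} \<in> edges X then 1 else 0)"
proof -
  have "e \<in> edges X \<and> x \<in> e \<and> y \<in> e \<longleftrightarrow> e = {x, y} \<and> {x, y} \<in> edges X" for e
  proof (cases "e \<in> edges X")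
    case True
    then have "card e = 2" using X by (simp add: simple_graph_def)
    then obtain p q where "e = {p, q}" by (auto simp: card_2_iff)
    with \<open>x \<noteq> y\<close> have "x \<in> e \<and> y \<in> e \<longleftrightarrow> e = {x, y}" by auto
    with True show ?thesis by metis
  qed auto
  then show ?thesis by (simp add: Collect_conv_if)
qed

text \<open>\<open>y\<close> corresponds to the edge \<open>{x, y}\<close>. With the count for
  distinct vertices this says that the incidence matrix times its transpose is D + A.\<close>

lemma card_edges_at:
  assumes X: "simple_graph X"
  shows "card {e \<in> edges X. x \<in> e} = degree_of X x"
proof -
  have "bij_betw (\<lambda>y. {x, y}) {y \<in> verts X. {x, y} \<in> edges X} {e \<in> edges X. x \<in> e}"
  proof (rule bij_betw_imageI)
    show "inj_on (\<lambda>y. {x, y}) {y \<in> verts X. {x, y} \<in> edges X}"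
      by (auto simp: inj_on_def doubleton_eq_iff)
    have "\<exists>y\<in>verts X. e = {x, y}" if e: "e \<in> edges X" "x \<in> e" for e
    proof -
      have "card e = 2" using e(1) X by (simp add: simple_graph_def)
    then obtain p q where "e = {p, q}" by (auto simp: card_2_iff)
      moreover have "e \<subseteq> verts X" using e(1) X by (simp add: simple_graph_def)
      ultimately show ?thesis using e(2) by blast
    qed
    then show "(\<lambda>y. {x, y}) ` {y \<in> verts X. {x, y} \<in> edges X} = {e \<in> edges X. x \<in> e}"
      by blast
  qed
  then show ?thesis unfolding degree_of_def by (rule bij_betw_same_card[symmetric])
qed

lemma degree_cycle:
  assumes "n \<ge> 3" and xs: "distinct xs" "set xs = verts X" "length xs = n"
    and adj: "\<And>i j. i < n \<Longrightarrow> j < n \<Longrightarrow>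
      {xs ! i, xs ! j} \<in> edges X \<longleftrightarrow> j = (i + 1) mod n \<or> i = (j + 1) mod n"
    and i: "i < n"
  shows "degree_of X (xs ! i) = 2"
proof -
  let ?p = "(i + 1) mod n" and ?q = "(i + (n - 1)) mod n"
  have pq: "?p < n" "?q < n" "?p \<noteq> ?q"
    using assms(1) cycle_neighbours_distinct[OF assms(1) i] by simp_all
  have "{y \<in> verts X. {xs ! i, y} \<in> edges X} = (!) xs ` {j. j < n \<and> {xs ! i, xs ! j} \<in> edges X}"
    unfolding xs(2)[symmetric] using xs(3) by (auto simp: in_set_conv_nth)
  also have "{j. j < n \<and> {xs ! i, xs ! j} \<in> edges X} = {?p, ?q}"
    using adj[OF i] cycle_neighbours[OF assms(1) i] pq by blast
  also have "(!) xs ` {?p, ?q} = {xs ! ?p, xs ! ?q}" by simp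
  also have "card \<dots> = 2" using pq xs by (simp add: nth_eq_iff_index_eq)
  finally show ?thesis by (simp add: degree_of_def)
qed

theorem theorem4p6:
  fixes F :: "'a ugraph" and H :: "'b ugraph"
    and E :: "'a set set" and a b :: "'a set \<Rightarrow> 'a"
    and u v :: 'b and n m r\<^sub>2 :: nat and \<zeta> \<eta> :: complex
  assumes "simple_graph F" and "graph_iso F (complete_graph n)" and "n \<ge> 3"
    and "E \<subseteq> edges F" and "card E = n"
    and "graph_iso (edge_induced E) (cycle_graph n)"
    and "verts (edge_induced E) = verts F"
    and "\<And>e. e \<in> E \<Longrightarrow> e = {a e, b e}"
    and "simple_graph H" and "order_of H = m" and "m \<ge> 3"
    and "{u, v} \<in> edges H"
    and "degree_of H u = m - 1" and "degree_of H v = m - 1"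
    and "regular (delete_verts H {u, v}) r\<^sub>2" and "r\<^sub>2 \<ge> 2"
    and "proots ((\<xi> - 2 * of_nat r\<^sub>2 - 2) * (\<xi> - of_nat m) - 2 * (of_nat m - 2)) = {#\<zeta>, \<eta>#}"
  shows "\<sigma> (Q (edge_pockets F E a b H u v)) =
      repeat_mset n (\<sigma> (Q H) - {#of_nat m - 2, \<zeta>, \<eta>#})
    + proots ((\<xi> - 2 * of_nat m - 2 * of_nat n + 6) * (\<xi> - 2 * of_nat r\<^sub>2 - 2)
        - 4 * (of_nat m - 2))
    + (\<Sum>l = 1..n - 1.
        proots ((\<xi> - 2 * of_nat m - of_nat n + 6) * (\<xi> - 2 * of_nat r\<^sub>2 - 2)
          - 2 * (of_nat m - 2) * [:1 + of_real (cos (2 * pi * of_nat l / of_nat n)):]))"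
proof -
  interpret edge_pocket_graph H u v r\<^sub>2 F E a b
    using assms by unfold_locales simp_all
  let ?C = "edge_induced E"
  let ?c = "card W"
  have m: "m = ?c + 2" using order_H assms(10) by simp
  have W: "W \<noteq> {}" using m assms(11) by auto
  have C: "simple_graph ?C"
    using assms(1,4,7) by (auto simp: simple_graph_def edge_induced_def)
  obtain xs where xs: "distinct xs" "set xs = verts ?C" "length xs = n"
    and adj: "\<And>i j. i < n \<Longrightarrow> j < n \<Longrightarrow>
      {xs ! i, xs ! j} \<in> edges ?C \<longleftrightarrow> j = (i + 1) mod n \<or> i = (j + 1) mod n"
    using cycle_graph_iso[OF assms(6)] by blast
  have xsF: "set xs = verts F" using xs(2) assms(7) by simp
  obtain es where es: "distinct es" "set es = E" using finite_distinct_list[OF finite_E] by blast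
  obtain ws where ws: "distinct ws" "set ws = W" using finite_distinct_list[OF finite_W] by blast
  note K_n = complete_graph_iso[OF assms(1,2)]
  have edges_C: "edges ?C = E" by (simp add: edge_induced_def)
  let ?\<phi> = "det (list_mat L ws ws)"
  let ?vs = "map Inl xs @ ps es ws"
  let ?D = "det (list_mat (lap_kernel G) ?vs ?vs)"
  \<comment> \<open>A vertex of \<open>F\<close> has degree \<open>n - 1 + 2 * (m - 2)\<close> in
    \<open>G\<close>. The constant is \<open>+ 6\<close> because the all-ones part \<beta> =
    -\<open>s\<close> is split off the diagonal too. With \<gamma> = -\<open>card W\<close>,
    \<open>?R\<close> is the circulant factor of index 0 and \<open>?P l\<close> the one of index
    \<open>l\<close>.\<close>
  let ?\<alpha> = "(\<xi> - 2 * of_nat m - of_nat n + 6) * s - 2 * of_nat ?c"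
  let ?R = "(\<xi> - 2 * of_nat m - 2 * of_nat n + 6) * s - 4 * (of_nat m - 2)"
  let ?P = "\<lambda>l. (\<xi> - 2 * of_nat m - of_nat n + 6) * s
          - 2 * (of_nat m - 2) * [:1 + of_real (cos (2 * pi * of_nat l / of_nat n)):]"
  have entry: "s * lap_kernel G (Inl (xs ! i)) (Inl (xs ! j)) -
      of_nat ?c * of_nat (card {e \<in> E. xs ! i \<in> e \<and> xs ! j \<in> e}) =
    (if i = j then ?\<alpha> else 0) + (- s) +
      (if j = (i + 1) mod n \<or> i = (j + 1) mod n then - of_nat ?c else 0)"
    if ij: "i < n" "j < n" for i j
  proof (cases "i = j")
    case True
    have x: "xs ! i \<in> verts F" using ij xs xsF by (metis nth_mem)
    have "card {e \<in> E. xs ! i \<in> e} = 2"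
      using card_edges_at[OF C, of "xs ! i"] degree_cycle[OF assms(3) xs adj ij(1)] edges_C by simp
    moreover from this have "degree_of G (Inl (xs ! i)) = n - 1 + 2 * ?c"
      using K_n(3)[OF x] degree_Inl[of "xs ! i"] by simp
    moreover have "{xs ! i} \<notin> edges F" by (rule simple_graph_no_loop[OF assms(1)])
    \<comment> \<open>No vertex is its own successor on the cycle, so the \<gamma> term is absent
      from the diagonal.\<close>
    moreover have "\<not> (i = (i + 1) mod n)" using assms(3) ij by (auto simp: mod_if)
    moreover have "of_nat (n - 1 + 2 * ?c) = (of_nat n - 1 + 2 * of_nat ?c :: complex poly)"
      using assms(3) by (simp add: of_nat_diff)
    ultimately show ?thesis
      using True edges_Inl_Inl[of "xs ! i" "xs ! i"]
      by (simp add: lap_kernel_def m) (simp add: algebra_simps)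
  next
    case False
    then have ne: "xs ! i \<noteq> xs ! j" using ij xs by (simp add: nth_eq_iff_index_eq)
    have "xs ! i \<in> verts F" "xs ! j \<in> verts F" using ij xs xsF by (metis nth_mem)+
    then have "{Inl (xs ! i), Inl (xs ! j)} \<in> edges G"
      using K_n(2) ne edges_Inl_Inl by simp
    moreover have "card {e \<in> E. xs ! i \<in> e \<and> xs ! j \<in> e} =
        (if j = (i + 1) mod n \<or> i = (j + 1) mod n then 1 else 0)"
      using card_edges_at_two[OF C ne] adj[OF ij] edges_C by simp
    ultimately show ?thesis using False ne by (simp add: lap_kernel_def)
  qed
  have mat: "list_mat (\<lambda>x y. s * lap_kernel G (Inl x) (Inl y) -
      of_nat ?c * of_nat (card {e \<in> E. x \<in> e \<and> y \<in> e})) xs xs =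
    mat n n (\<lambda>(i, j). (if i = j then ?\<alpha> else 0) + (- s) +
      (if j = (i + 1) mod n \<or> i = (j + 1) mod n then - of_nat ?c else 0))"
    unfolding list_mat_def xs(3) by (rule cong_mat) (auto simp: entry simp del: of_nat_add)
  have R: "?\<alpha> + of_nat n * (- s) + 2 * (- of_nat ?c) = ?R"
    by (simp add: m algebra_simps)
  have P: "?\<alpha> + 2 * (- of_nat ?c) * [:of_real (cos (2 * pi * real l / real n)):] = ?P l" for l
  proof -
    have one: "[:1 + z:] = 1 + [:z:]" for z :: complex by (simp add: one_pCons)
    show ?thesis unfolding one by (simp add: m algebra_simps)
  qed
  have D: "?D * s ^ n = ?R * (\<Prod>l = 1..n - 1. ?P l) * ?\<phi> ^ n"
    using det_lap_kernel_G[OF xs(1) xsF es ws]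
    unfolding mat det_cycle_circulant[OF assms(3)] R P K_n(1) assms(5) .
  have roots: "proots (s * (\<xi> - of_nat (order_of H)) - 2 * (of_nat (order_of H) - 2)) = {#\<zeta>, \<eta>#}"
    using assms(17) by (simp add: s_def assms(10))
  note H_spec = spectrum_H[OF ws W roots]
  note vs = distinct_vertex_list[OF xs(1) xsF es ws]
  note s0 = proots_s s_nonzero
  \<comment> \<open>Both \<open>?D\<close> and \<open>s\<close> are nonzero, so no factor on the
    right of \<open>D\<close> vanishes and the roots of both sides split.\<close>
  have D0: "?D \<noteq> 0" by (rule det_lap_kernel_nonzero[OF vs(1)])
  then have "?R * (\<Prod>l = 1..n - 1. ?P l) * ?\<phi> ^ n \<noteq> 0"
    using s0(2) unfolding D[symmetric] by (simp only: mult_eq_0_iff power_eq_0_iff simp_thms)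
  then have nz: "?R \<noteq> 0" "(\<Prod>l = 1..n - 1. ?P l) \<noteq> 0" "?\<phi> ^ n \<noteq> 0"
    unfolding mult_eq_0_iff de_Morgan_disj by blast+
  have nzP: "?P l \<noteq> 0" if "l \<in> {1..n - 1}" for l
    using nz(2) that unfolding prod_zero_iff[OF finite_atLeastAtMost] by blast
  \<comment> \<open>Used with \<open>z\<close> the root of \<open>s\<close>: it occurs
    \<open>n\<close> times from \<open>s ^ n\<close> and once in each of the \<open>n\<close>
    factors \<phi>. What is left of each \<phi> is the multiset of (i).\<close>
  have cancel: "A = repeat_mset n X + B + C"
    if "A + repeat_mset n {#z#} = B + C + repeat_mset n (add_mset z X)"
    for A B C X :: "complex multiset" and z
    using that by simp
  have "proots ?D + repeat_mset n (proots s) = proots (?D * s ^ n)"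
    using D0 s0(2) by (simp only: proots_mult proots_power power_eq_0_iff simp_thms)
  also have "\<dots> = proots ?R + proots (\<Prod>l = 1..n - 1. ?P l) + repeat_mset n (proots ?\<phi>)"
    unfolding D using nz by (simp only: proots_mult proots_power mult_eq_0_iff simp_thms)
  also have "proots (\<Prod>l = 1..n - 1. ?P l) = (\<Sum>l = 1..n - 1. proots (?P l))"
    using nzP by (rule proots_prod)
  finally have "proots ?D = repeat_mset n (\<sigma> (Q H) - {#of_nat m - 2, \<zeta>, \<eta>#}) + proots ?R +
      (\<Sum>l = 1..n - 1. proots (?P l))"
    unfolding H_spec[symmetric] s0 assms(10) by (rule cancel)
  then show ?thesis
    using spectrum_Q_lap_kernel[OF vs] by (simp only: s_def)
qed

end
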